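(* For every integer $n \geq 1$ we have $M_3(n) = \lceil n^2/2\rceil$. Furthermore, if $A \subseteq \mathbb{Z}$ is a set with $|A| = n$ and $T_3(A) = M_3(n)$, then $A$ is an affine image (that is, the image under a map $x \mapsto ax+b$ with $a,b \in \mathbb{Z}$, $a \neq 0$) of some set $E(k,m)$ or $F(k,m)$ with $k,m \in \mathbb{N}\cup\{0\}$.
   Context: For a finite set $A$ in an abelian group $G$, $T_3(A)$ denotes the number of pairs $(x,d) \in G \times G$ such that $x, x+d, x+2d \in A$ (this counts the trivial progressions with $d=0$, and counts each nontrivial progression twice, via $d$ and $-d$). For $n \in \mathbb{N}$, $M_3(n)$ is the maximum of $T_3(A)$ over all sets $A \subseteq \mathbb{Z}$ with $|A| = n$. For $k,m \in \mathbb{N}\cup\{0\}$, $E(k,m) := \{-k-2m,\dots,-k-2,-k,-k+1,\dots,-1,0,1,\dots,k-1,k,k+2,\dots,k+2m\}$ and $F(k,m) := \{-k-2m+2,\dots,-k-2,-k,-k+1,\dots,-1,0,1,\dots,k-1,k,k+2,\dots,k+2m\}$; that is, $E(k,m)$ consists of all integers in $[-k,k]$ together with the integers $\pm(k+2j)$ for $1\le j\le m$, and $F(k,m)$ consists of all integers in $[-k,k]$ together with $k+2j$ for $1 \le j \le m$ and $-(k+2j)$ for $1 \le j \le m-1$. Thus $|E(k,m)| = 2k+2m+1$ and $|F(k,m)| = 2k+2m$.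
   Formalization: For m = 0, F(k,0) is taken to be {-k+1,...,k}, of size 2k, not all integers in [-k,k]; the prose description contradicts |F(k,m)| = 2k+2m there and would make the claim false for A = {0,1}. *)

theory Defs
  imports Complex_Main
begin

definition T3 :: "'a::ab_group_add set \<Rightarrow> nat" where
  "T3 A = card {(x, d). x \<in> A \<and> x + d \<in> A \<and> x + (d + d) \<in> A}"

definition M3 :: "nat \<Rightarrow> nat" where
  "M3 n = Max {T3 A | A :: int set. finite A \<and> card A = n}"

definition E :: "nat \<Rightarrow> nat \<Rightarrow> int set" where
  "E k m = {- int k..int k} \<union> {int k + 2 * int j | j. 1 \<le> j \<and> j \<le> m}
     \<union> {- (int k + 2 * int j) | j. 1 \<le> j \<and> j \<le> m}"

(* F(k,m) = {-k-2m+2, ..., -k-2, -k, -k+1, ..., k-1, k, k+2, ..., k+2m}: the left-hand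
   progression -k-2m+2, ..., -k-2, -k of step 2 has m terms, so it is empty for m = 0 and
   F(k,0) = {-k+1..k}. This is the reading for which |F(k,m)| = 2k+2m for all k and m; it is
   needed because {1..2k} is extremal but is not the image of F(0,k) under x |-> ax+b with
   integer a. For m >= 1 the set contains all of [-k,k] (lemma F_pos). *)
definition F :: "nat \<Rightarrow> nat \<Rightarrow> int set" where
  "F k m = {- int k - 2 * int j | j. j < m} \<union> {- int k + 1..int k}
     \<union> {int k + 2 * int j | j. 1 \<le> j \<and> j \<le> m}"

lemma M3_set_finite: "finite {T3 A | A :: int set. finite A \<and> card A = n}"
proof (rule finite_subset)
  show "{T3 A | A :: int set. finite A \<and> card A = n} \<subseteq> {..n * n}"
  proof clarify
    fix A :: "int set"
    assume A: "finite A" "n = card A"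
    have "T3 A \<le> card (A \<times> A)"
      unfolding T3_def
      by (rule card_inj_on_le[where f = "\<lambda>(x, d). (x, x + d)"]) (use A in \<open>auto simp: inj_on_def\<close>)
    then show "T3 A \<le> card A * card A"
      by (simp add: card_cartesian_product)
  qed
qed simp

lemma M3_set_nonempty: "{T3 A | A :: int set. finite A \<and> card A = n} \<noteq> {}"
  using infinite_arbitrarily_large[OF infinite_UNIV_int, of n] by blast

lemma F_pos:
  assumes "1 \<le> m"
  shows "F k m = {- int k..int k} \<union> {int k + 2 * int j | j. 1 \<le> j \<and> j \<le> m}
     \<union> {- (int k + 2 * int j) | j. 1 \<le> j \<and> j \<le> m - 1}"
proof -
  have "{- int k - 2 * int j | j. j < m} =
      insert (- int k) {- (int k + 2 * int j) | j. 1 \<le> j \<and> j \<le> m - 1}"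
    (is "?L = ?R")
  proof
    show "?L \<subseteq> ?R"
    proof
      fix x assume "x \<in> ?L"
      then obtain j where j: "x = - int k - 2 * int j" "j < m" by blast
      show "x \<in> ?R"
      proof (cases "j = 0")
        case False
        then have "x = - (int k + 2 * int j) \<and> 1 \<le> j \<and> j \<le> m - 1" using j by auto
        then show ?thesis by blast
      qed (use j in simp)
    qed
    show "?R \<subseteq> ?L"
      using assms by (auto intro: exI[of _ 0])
  qed
  moreover have "{- int k..int k} = insert (- int k) {- int k + 1..int k}"
    by auto
  ultimately show ?thesis
    unfolding F_def by auto
qed

lemma card_E: "card (E k m) = 2 * k + 2 * m + 1"
proof -
  have eq: "E k m = {- int k..int k} \<union> (\<lambda>j. int k + 2 * int j) ` {1..m}
      \<union> (\<lambda>j. - int k + (- 2) * int j) ` {1..m}"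
    unfolding E_def by (auto simp: image_iff)
  show ?thesis
    unfolding eq
    by (subst card_Un_disjoint; (subst card_Un_disjoint)?)
       (auto simp: card_image inj_on_def)
qed

lemma card_F: "card (F k m) = 2 * k + 2 * m"
proof -
  have eq: "F k m = (\<lambda>j. - int k + (- 2) * int j) ` {..<m} \<union> {- int k + 1..int k}
      \<union> (\<lambda>j. int k + 2 * int j) ` {1..m}"
    unfolding F_def by (auto simp: image_iff)
  show ?thesis
    unfolding eq
    by (subst card_Un_disjoint; (subst card_Un_disjoint)?)
       (auto simp: card_image inj_on_def)
qed

end

theory Submission
  imports Defs
begin

text \<open>
  For an element \<open>c\<close> of a set \<open>A\<close> of \<open>n\<close> integers, the progressions with middle term \<open>c\<close> number
  at most \<open>1 + 2 min(l, r)\<close>, where \<open>l\<close> and \<open>r\<close> count the elements of \<open>A\<close> to the left and to the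
  right of \<open>c\<close>. Summing over \<open>c\<close> gives the bound, and equality forces \<open>2c - x \<in> A\<close> for all \<open>x\<close> on
  the shorter side of \<open>c\<close>. This property survives the removal of both end points, so for odd \<open>n\<close>
  induction makes \<open>A\<close> a set \<open>E(k,m)\<close> plus a symmetric pair of end points; reflecting the new
  maximum in the largest and in the smallest positive element leaves at most two positions for it.
  For even \<open>n\<close> the removal of a suitable one of the two end points leaves an extremal set of odd
  size, and the same computation locates the removed point.
\<close>

section \<open>Progressions with a given middle term\<close>

definition num_below :: "int set \<Rightarrow> int \<Rightarrow> nat" where
  "num_below A c = card {x \<in> A. x < c}"

definition num_above :: "int set \<Rightarrow> int \<Rightarrow> nat" where
  "num_above A c = card {x \<in> A. c < x}"

text \<open>Each nontrivial progression with middle term \<open>c\<close> is counted once, through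
  its smaller end.\<close>

definition paired :: "int set \<Rightarrow> int \<Rightarrow> nat" where
  "paired A c = card {x \<in> A. x < c \<and> 2 * c - x \<in> A}"

text \<open>Equality in the bound at every middle term at once; \<open>T3_eq_iff_extremal\<close>
  identifies this with equality in the bound for \<open>T3\<close>. Stated locally, the property can
  be followed through the removal of points.\<close>

definition extremal :: "int set \<Rightarrow> bool" where
  "extremal A \<longleftrightarrow> finite A \<and> (\<forall>c\<in>A. paired A c = min (num_below A c) (num_above A c))"

lemma paired_eq_upper: "paired A c = card {x \<in> A. c < x \<and> 2 * c - x \<in> A}"
proof -
  have "bij_betw (\<lambda>x. 2 * c - x) {x \<in> A. x < c \<and> 2 * c - x \<in> A} {x \<in> A. c < x \<and> 2 * c - x \<in> A}"
    by (rule bij_betw_byWitness[where f' = "\<lambda>x. 2 * c - x"]) auto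
  then show ?thesis
    unfolding paired_def by (rule bij_betw_same_card)
qed

lemma paired_le_below: "finite A \<Longrightarrow> paired A c \<le> num_below A c"
  unfolding paired_def num_below_def by (rule card_mono) auto

lemma paired_le_above: "finite A \<Longrightarrow> paired A c \<le> num_above A c"
  unfolding paired_eq_upper num_above_def by (rule card_mono) auto

lemma paired_eq_below_iff:
  assumes "finite A"
  shows "paired A c = num_below A c \<longleftrightarrow> (\<forall>x\<in>A. x < c \<longrightarrow> 2 * c - x \<in> A)"
proof
  assume "paired A c = num_below A c"
  then have "{x \<in> A. x < c \<and> 2 * c - x \<in> A} = {x \<in> A. x < c}"
    unfolding paired_def num_below_def using assms by (intro card_subset_eq) auto
  then show "\<forall>x\<in>A. x < c \<longrightarrow> 2 * c - x \<in> A" by blast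
next
  assume "\<forall>x\<in>A. x < c \<longrightarrow> 2 * c - x \<in> A"
  then show "paired A c = num_below A c"
    unfolding paired_def num_below_def by (intro arg_cong[where f = card]) auto
qed

lemma paired_eq_above_iff:
  assumes "finite A"
  shows "paired A c = num_above A c \<longleftrightarrow> (\<forall>x\<in>A. c < x \<longrightarrow> 2 * c - x \<in> A)"
proof
  assume "paired A c = num_above A c"
  then have "{x \<in> A. c < x \<and> 2 * c - x \<in> A} = {x \<in> A. c < x}"
    unfolding paired_eq_upper num_above_def using assms by (intro card_subset_eq) auto
  then show "\<forall>x\<in>A. c < x \<longrightarrow> 2 * c - x \<in> A" by blast
next
  assume "\<forall>x\<in>A. c < x \<longrightarrow> 2 * c - x \<in> A"
  then show "paired A c = num_above A c"
    unfolding paired_eq_upper num_above_def by (intro arg_cong[where f = card]) auto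
qed

text \<open>Reflection in \<open>c\<close> matches the paired elements of one side with those of the
  other, so \<open>paired\<close> reaches the size of a side exactly when that whole side reflects
  into \<open>A\<close>. If the two sides are equally large, both implications apply.\<close>

lemma extremal_iff:
  "extremal A \<longleftrightarrow> finite A \<and> (\<forall>c\<in>A.
     (num_below A c \<le> num_above A c \<longrightarrow> (\<forall>x\<in>A. x < c \<longrightarrow> 2 * c - x \<in> A)) \<and>
     (num_above A c \<le> num_below A c \<longrightarrow> (\<forall>x\<in>A. c < x \<longrightarrow> 2 * c - x \<in> A)))"
  unfolding extremal_def
  by (intro conj_cong refl ball_cong)
     (auto simp flip: paired_eq_below_iff paired_eq_above_iff simp: min_def)

lemma extremal_below:
  "\<lbrakk>extremal A; c \<in> A; num_below A c \<le> num_above A c; x \<in> A; x < c\<rbrakk> \<Longrightarrow> 2 * c - x \<in> A"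
  unfolding extremal_iff by blast

lemma extremal_above:
  "\<lbrakk>extremal A; c \<in> A; num_above A c \<le> num_below A c; x \<in> A; c < x\<rbrakk> \<Longrightarrow> 2 * c - x \<in> A"
  unfolding extremal_iff by blast

section \<open>Ranks, the upper bound and its equality case\<close>

lemma below_less:
  assumes "finite A" "x \<in> A" "x < y"
  shows "num_below A x < num_below A y"
  unfolding num_below_def using assms by (intro psubset_card_mono) auto

lemma below_mono: "\<lbrakk>finite A; x \<le> y\<rbrakk> \<Longrightarrow> num_below A x \<le> num_below A y"
  unfolding num_below_def by (rule card_mono) auto

lemma above_antimono: "\<lbrakk>finite A; x \<le> y\<rbrakk> \<Longrightarrow> num_above A y \<le> num_above A x"
  unfolding num_above_def by (rule card_mono) auto

lemma below_plus_above:
  assumes "finite A" "c \<in> A"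
  shows "num_below A c + num_above A c + 1 = card A"
proof -
  have eq: "A = insert c ({x \<in> A. x < c} \<union> {x \<in> A. c < x})"
    using assms(2) by auto
  have "card A = Suc (card ({x \<in> A. x < c} \<union> {x \<in> A. c < x}))"
    by (subst eq, rule card_insert_disjoint) (use assms in auto)
  also have "card ({x \<in> A. x < c} \<union> {x \<in> A. c < x}) = num_below A c + num_above A c"
    unfolding num_below_def num_above_def by (rule card_Un_disjoint) (use assms in auto)
  finally show ?thesis by simp
qed

text \<open>\<open>num_below A\<close> is the rank function of \<open>A\<close>: it is strictly
  increasing on \<open>A\<close> with values below \<open>card A\<close>, and an injection between
  finite sets of equal size is onto.\<close>

lemma bij_betw_below:
  assumes "finite A"
  shows "bij_betw (num_below A) A {..<card A}"
proof -
  have inj: "inj_on (num_below A) A"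
    by (rule linorder_inj_onI) (use below_less[OF assms] in \<open>auto simp: less_le\<close>)
  have "num_below A ` A \<subseteq> {..<card A}"
    using below_plus_above[OF assms] by fastforce
  then have "num_below A ` A = {..<card A}"
    using inj by (intro card_subset_eq) (auto simp: card_image)
  with inj show ?thesis by (simp add: bij_betw_def)
qed

lemma sum_min_reflect: "(\<Sum>i<n. 1 + 2 * min i (n - 1 - i)) = (n\<^sup>2 + 1) div (2::nat)"
proof (induction n rule: induct_nat_012)
  case (ge2 n)
  have "(\<Sum>i<Suc (Suc n). 1 + 2 * min i (Suc (Suc n) - 1 - i))
      = 2 + (\<Sum>i<n. 1 + 2 * min (Suc i) (n - i))"
    by (subst sum.lessThan_Suc_shift) simp
  also have "(\<Sum>i<n. 1 + 2 * min (Suc i) (n - i)) = (\<Sum>i<n. (1 + 2 * min i (n - 1 - i)) + 2)"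
    by (intro sum.cong) (auto simp: min_def)
  also have "\<dots> = (n\<^sup>2 + 1) div 2 + 2 * n"
    by (subst sum.distrib, subst ge2(1)) simp
  also have "2 + \<dots> = ((Suc (Suc n))\<^sup>2 + 1) div 2"
    by (simp add: power2_eq_square)
  finally show ?case .
qed simp_all

lemma sum_min_below_above:
  assumes "finite A"
  shows "(\<Sum>c\<in>A. 1 + 2 * min (num_below A c) (num_above A c)) = ((card A)\<^sup>2 + 1) div 2"
proof -
  have "num_above A c = card A - 1 - num_below A c" if "c \<in> A" for c
    using below_plus_above[OF assms that] by linarith
  then have "(\<Sum>c\<in>A. 1 + 2 * min (num_below A c) (num_above A c))
      = (\<Sum>c\<in>A. 1 + 2 * min (num_below A c) (card A - 1 - num_below A c))"
    by (intro sum.cong) auto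
  also have "\<dots> = (\<Sum>i<card A. 1 + 2 * min i (card A - 1 - i))"
    by (rule sum.reindex_bij_betw[OF bij_betw_below[OF assms]])
  finally show ?thesis by (simp only: sum_min_reflect)
qed

text \<open>Progressions are sorted by their middle term \<open>c = x + d\<close>. The 1 is the
  trivial progression, and the factor 2 accounts for the two signs of \<open>d\<close>, which
  exchange the ends on either side of \<open>c\<close>.\<close>

lemma T3_eq_sum_paired:
  fixes A :: "int set"
  assumes "finite A"
  shows "T3 A = (\<Sum>c\<in>A. 1 + 2 * paired A c)"
proof -
  have "bij_betw (\<lambda>(x, d). (x + d, x)) {(x, d). x \<in> A \<and> x + d \<in> A \<and> x + (d + d) \<in> A}
      (SIGMA c:A. {x \<in> A. 2 * c - x \<in> A})"
    by (rule bij_betw_byWitness[where f' = "\<lambda>(c, x). (x, c - x)"])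
       (auto simp: algebra_simps)
  then have "T3 A = card (SIGMA c:A. {x \<in> A. 2 * c - x \<in> A})"
    unfolding T3_def by (rule bij_betw_same_card)
  also have "\<dots> = (\<Sum>c\<in>A. card {x \<in> A. 2 * c - x \<in> A})"
    using assms by simp
  also have "\<dots> = (\<Sum>c\<in>A. 1 + 2 * paired A c)"
  proof (rule sum.cong)
    fix c assume c: "c \<in> A"
    let ?L = "{x \<in> A. x < c \<and> 2 * c - x \<in> A}" and ?R = "{x \<in> A. c < x \<and> 2 * c - x \<in> A}"
    have "{x \<in> A. 2 * c - x \<in> A} = insert c (?L \<union> ?R)"
      using c by auto
    then have "card {x \<in> A. 2 * c - x \<in> A} = card (insert c (?L \<union> ?R))"
      by (rule arg_cong)
    also have "\<dots> = Suc (card (?L \<union> ?R))"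
      by (rule card_insert_disjoint) (use assms in auto)
    also have "\<dots> = Suc (card ?L + card ?R)"
      by (intro arg_cong[where f = Suc] card_Un_disjoint finite_subset[OF _ assms]) auto
    also have "\<dots> = 1 + 2 * paired A c"
      unfolding paired_def[symmetric] paired_eq_upper[symmetric] by simp
    finally show "card {x \<in> A. 2 * c - x \<in> A} = 1 + 2 * paired A c" .
  qed simp
  finally show ?thesis .
qed

lemma T3_le:
  fixes A :: "int set"
  assumes "finite A"
  shows "T3 A \<le> ((card A)\<^sup>2 + 1) div 2"
  unfolding T3_eq_sum_paired[OF assms] sum_min_below_above[OF assms, symmetric]
  by (intro sum_mono) (simp add: paired_le_below paired_le_above assms)

text \<open>Both sides are sums over the middle terms, and the bound holds summand by summand; hence
  the sums agree only if all summands agree.\<close>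

lemma T3_eq_iff_extremal:
  assumes "finite A"
  shows "T3 A = ((card A)\<^sup>2 + 1) div 2 \<longleftrightarrow> extremal A"
proof
  assume "T3 A = ((card A)\<^sup>2 + 1) div 2"
  then have eq: "(\<Sum>c\<in>A. 1 + 2 * paired A c) = (\<Sum>c\<in>A. 1 + 2 * min (num_below A c) (num_above A c))"
    by (simp only: T3_eq_sum_paired[OF assms] sum_min_below_above[OF assms])
  have "1 + 2 * paired A c = 1 + 2 * min (num_below A c) (num_above A c)" if "c \<in> A" for c
    by (rule sum_mono_inv[OF eq _ that assms]) (simp add: paired_le_below paired_le_above assms)
  then show "extremal A"
    unfolding extremal_def using assms by auto
next
  assume "extremal A"
  then have "(\<Sum>c\<in>A. 1 + 2 * paired A c) = (\<Sum>c\<in>A. 1 + 2 * min (num_below A c) (num_above A c))"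
    unfolding extremal_def by (intro sum.cong) auto
  then show "T3 A = ((card A)\<^sup>2 + 1) div 2"
    by (simp only: T3_eq_sum_paired[OF assms] sum_min_below_above[OF assms])
qed

lemma extremal_interval: "extremal {0..<int n}"
proof -
  have "num_below {0..<int n} c = nat c" "num_above {0..<int n} c = nat (int n - 1 - c)"
    if "c \<in> {0..<int n}" for c
  proof -
    have "{x \<in> {0..<int n}. x < c} = {0..<c}" "{x \<in> {0..<int n}. c < x} = {c<..<int n}"
      using that by auto
    then show "num_below {0..<int n} c = nat c" "num_above {0..<int n} c = nat (int n - 1 - c)"
      by (auto simp: num_below_def num_above_def algebra_simps)
  qed
  then show ?thesis
    unfolding extremal_iff by auto
qed

lemma M3_eq: "M3 n = (n\<^sup>2 + 1) div 2" if "n \<ge> 1"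
  unfolding M3_def
proof (rule Max_eqI)
  show "finite {T3 A |A :: int set. finite A \<and> card A = n}"
    by (rule M3_set_finite)
  show "y \<le> (n\<^sup>2 + 1) div 2" if "y \<in> {T3 A |A :: int set. finite A \<and> card A = n}" for y
    using that T3_le by blast
  show "(n\<^sup>2 + 1) div 2 \<in> {T3 A |A :: int set. finite A \<and> card A = n}"
    using T3_eq_iff_extremal[of "{0..<int n}"] extremal_interval[of n]
    by (auto intro!: exI[of _ "{0..<int n}"])
qed

section \<open>Mirror images and removal of end points\<close>

lemma below_uminus: "num_below (uminus ` A) (- c) = num_above A c"
proof -
  have "{x \<in> uminus ` A. x < - c} = uminus ` {x \<in> A. c < x}" by auto
  then show ?thesis by (simp add: num_below_def num_above_def card_image)
qed

lemma above_uminus: "num_above (uminus ` A) (- c) = num_below A c"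
proof -
  have "{x \<in> uminus ` A. - c < x} = uminus ` {x \<in> A. x < c}" by auto
  then show ?thesis by (simp add: num_below_def num_above_def card_image)
qed

lemma paired_uminus: "paired (uminus ` A) (- c) = paired A c"
proof -
  have mem: "y \<in> uminus ` A \<longleftrightarrow> - y \<in> A" for y
    by (metis image_iff minus_minus)
  have "bij_betw uminus {x \<in> A. c < x \<and> 2 * c - x \<in> A}
      {x \<in> uminus ` A. x < - c \<and> 2 * - c - x \<in> uminus ` A}"
    unfolding mem by (rule bij_betw_byWitness[where f' = uminus]) (auto simp: algebra_simps)
  then show ?thesis
    unfolding paired_eq_upper[of A] paired_def[of "uminus ` A"]
    by (rule bij_betw_same_card[symmetric])
qed

lemma extremal_uminus: "extremal A \<Longrightarrow> extremal (uminus ` A)"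
  unfolding extremal_def by (simp add: below_uminus above_uminus paired_uminus min.commute)

text \<open>Both side counts of an inner point \<open>c\<close> drop by one, so the comparison
  between its sides is unchanged. The end point on a shorter side reflects in \<open>c\<close> to a
  point of \<open>A\<close>; any other point of that side reflects to a place strictly nearer to
  \<open>c\<close>, hence not to an end point.\<close>

lemma extremal_remove_ends:
  assumes ext: "extremal A" and card: "card A \<ge> 2"
  shows "extremal (A - {Min A, Max A})"
proof -
  let ?B = "A - {Min A, Max A}"
  have fin: "finite A" using ext by (simp add: extremal_def)
  have ne: "A \<noteq> {}" using card by auto
  have mem: "Min A \<in> A" "Max A \<in> A" using fin ne by auto
  have bd: "Min A < c" "c < Max A" if "c \<in> ?B" for c
    using that fin by (auto simp: less_le)
  have below: "num_below A c = num_below ?B c + 1" if "c \<in> ?B" for c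
  proof -
    have "{x \<in> A. x < c} = insert (Min A) {x \<in> ?B. x < c}"
      using bd[OF that] mem by auto
    then show ?thesis using fin by (simp add: num_below_def)
  qed
  have above: "num_above A c = num_above ?B c + 1" if "c \<in> ?B" for c
  proof -
    have "{x \<in> A. c < x} = insert (Max A) {x \<in> ?B. c < x}"
      using bd[OF that] mem by auto
    then show ?thesis using fin by (simp add: num_above_def)
  qed
  show ?thesis
    unfolding extremal_iff
  proof (intro conjI ballI impI)
    show "finite ?B" using fin by simp
  next
    fix c x assume c: "c \<in> ?B" and le: "num_below ?B c \<le> num_above ?B c" and x: "x \<in> ?B" "x < c"
    have "num_below A c \<le> num_above A c" using le below above c by simp
    then have "2 * c - x \<in> A" "2 * c - Min A \<in> A"
      using extremal_below[OF ext, of c] c x bd mem by auto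
    moreover from this(2) have "2 * c - Min A \<le> Max A" using fin by simp
    ultimately show "2 * c - x \<in> ?B" using bd[OF x(1)] bd[OF c] x by auto
  next
    fix c x assume c: "c \<in> ?B" and le: "num_above ?B c \<le> num_below ?B c" and x: "x \<in> ?B" "c < x"
    have "num_above A c \<le> num_below A c" using le below above c by simp
    then have "2 * c - x \<in> A" "2 * c - Max A \<in> A"
      using extremal_above[OF ext, of c] c x bd mem by auto
    moreover from this(2) have "Min A \<le> 2 * c - Max A" using fin by simp
    ultimately show "2 * c - x \<in> ?B" using bd[OF x(1)] bd[OF c] x by auto
  qed
qed

text \<open>Here \<open>c0\<close> is the left one of the two middle elements. To the right of it,
  the loss of \<open>Max A\<close> costs each point at most one pair, which matches the drop in its
  shorter side. From \<open>c0\<close> leftwards the shorter side keeps its size, so no pair may be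
  lost; the hypothesis on \<open>Min A + Max A\<close> secures this at \<open>c0\<close>
  itself.\<close>

lemma extremal_remove_Max:
  assumes ext: "extremal A" and card: "card A = 2 * p"
    and c0: "c0 \<in> A" "num_below A c0 + 1 = p" and ne: "Min A + Max A \<noteq> 2 * c0"
  shows "extremal (A - {Max A})"
proof -
  let ?M = "Max A"
  let ?B = "A - {?M}"
  have fin: "finite A" using ext by (simp add: extremal_def)
  have mem: "Min A \<in> A" "?M \<in> A" using fin c0 by (auto intro: Min_in Max_in)
  have "paired ?B c = min (num_below ?B c) (num_above ?B c)" if cB: "c \<in> ?B" for c
  proof -
    have c: "c \<in> A" "c < ?M" using cB fin by (auto simp: less_le)
    have below: "num_below A c = num_below ?B c"
      unfolding num_below_def using c by (intro arg_cong[where f = card]) auto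
    have "{x \<in> A. c < x} = insert ?M {x \<in> ?B. c < x}" using c mem by auto
    then have above: "num_above A c = num_above ?B c + 1" using fin by (simp add: num_above_def)
    have sets: "{x \<in> ?B. x < c \<and> 2 * c - x \<in> ?B}
        = {x \<in> A. x < c \<and> 2 * c - x \<in> A} - {2 * c - ?M}"
      using c by auto
    have paired: "paired A c = min (num_below A c) (num_above A c)"
      using ext c by (simp add: extremal_def)
    have tot: "num_below A c + num_above A c + 1 = 2 * p"
      using below_plus_above[OF fin c(1)] card by simp
    show ?thesis
    proof (cases "num_below A c < num_above A c")
      case False
      have "paired A c \<le> paired ?B c + 1"
        unfolding paired_def sets using fin by (subst card_Diff_singleton_if) auto
      then show ?thesis
        using False paired below above paired_le_above[of ?B c] fin by auto
    next
      case True
      \<comment> \<open>If \<open>2 * c - ?M\<close> were in \<open>A\<close>, its reflection in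
        \<open>c0\<close> would be \<open>?M + 2 * (c0 - c)\<close>, which cannot exceed
        \<open>?M\<close>; this forces \<open>c = c0\<close>. Then reflecting \<open>Min A\<close>
        in \<open>c0\<close> as well makes \<open>c0\<close> the midpoint of the two end points,
        which is excluded.\<close>
      have "2 * c - ?M \<notin> A"
      proof
        assume in_A: "2 * c - ?M \<in> A"
        have refl: "2 * c0 - x \<le> ?M" if "x \<in> A" "x < c0" for x
          using extremal_below[OF ext c0(1) _ that] below_plus_above[OF fin c0(1)] card c0 fin
          by auto
        have "num_below A c \<le> num_below A c0" using True tot c0 by linarith
        then have "c \<le> c0" using below_less[OF fin c0(1), of c] by linarith
        moreover have "c0 \<le> c" using refl[OF in_A] c \<open>c \<le> c0\<close> by linarith
        moreover have "Min A \<le> 2 * c - ?M" using in_A fin by simp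
        ultimately show False using refl[OF mem(1)] ne c by linarith
      qed
      then have "paired ?B c = paired A c" unfolding paired_def sets by simp
      then show ?thesis using True paired below above by auto
    qed
  qed
  then show ?thesis using fin by (simp add: extremal_def)
qed

text \<open>The two middle elements \<open>c\<close> and \<open>c'\<close> cannot both be the
  midpoint of \<open>Min A\<close> and \<open>Max A\<close>. If \<open>c\<close> is not, the maximum
  can go; otherwise \<open>c'\<close> is not, and the mirrored argument removes the minimum.\<close>

lemma extremal_remove_Min_or_Max:
  assumes ext: "extremal A" and card: "card A = 2 * p" and "p \<ge> 1"
  shows "extremal (A - {Max A}) \<or> extremal (A - {Min A})"
proof -
  have fin: "finite A" using ext by (simp add: extremal_def)
  have img: "num_below A ` A = {..<2 * p}"
    using bij_betw_below[OF fin] card by (simp add: bij_betw_def)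
  then obtain c where c: "c \<in> A" "num_below A c + 1 = p"
    using \<open>p \<ge> 1\<close> by (force simp: set_eq_iff image_iff dest: spec[of _ "p - 1"])
  from img obtain c' where c': "c' \<in> A" "num_below A c' = p"
    using \<open>p \<ge> 1\<close> by (force simp: set_eq_iff image_iff dest: spec[of _ "p"])
  show ?thesis
  proof (cases "Min A + Max A = 2 * c")
    case False
    then show ?thesis using extremal_remove_Max[OF ext card c] by simp
  next
    case True
    have "c \<noteq> c'" using c c' by auto
    have neA: "A \<noteq> {}" using c by auto
    have Max: "Max (uminus ` A) = - Min A"
      using fin neA by (intro Max_eqI) auto
    have Min: "Min (uminus ` A) = - Max A"
      using fin neA by (intro Min_eqI) auto
    have "extremal (uminus ` A - {Max (uminus ` A)})"
    proof (rule extremal_remove_Max)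
      show "extremal (uminus ` A)" by (rule extremal_uminus[OF ext])
      show "card (uminus ` A) = 2 * p" using card by (simp add: card_image)
      show "- c' \<in> uminus ` A" using c' by simp
      \<comment> \<open>Mirroring exchanges the two middle elements, so \<open>- c'\<close> is the
        left one of the mirrored set.\<close>
      show "num_below (uminus ` A) (- c') + 1 = p"
        using below_plus_above[OF fin c'(1)] card c' by (simp add: below_uminus)
      show "Min (uminus ` A) + Max (uminus ` A) \<noteq> 2 * - c'"
        using True Max Min \<open>c \<noteq> c'\<close> by simp
    qed
    then have "extremal (uminus ` (uminus ` A - {- Min A}))"
      unfolding Max by (rule extremal_uminus)
    also have "uminus ` (uminus ` A - {- Min A}) = A - {Min A}"
      by (simp add: image_set_diff image_image)
    finally show ?thesis ..
  qed
qed

section \<open>The sets \<open>E k m\<close> and \<open>F k m\<close> and their affine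
  images\<close>

lemma uminus_mem_E: "x \<in> E k m \<Longrightarrow> - x \<in> E k m"
  unfolding E_def by auto

lemma E_bounds: "x \<in> E k m \<Longrightarrow> \<bar>x\<bar> \<le> int k + 2 * int m"
  unfolding E_def by auto

lemma max_mem_E: "int k + 2 * int m \<in> E k m"
  unfolding E_def by (cases "m = 0") auto

lemma zero_mem_E: "0 \<in> E k m"
  unfolding E_def by auto

lemma E_Suc_right:
  "E k (Suc m) = {int k + 2 * int m + 2, - (int k + 2 * int m + 2)} \<union> E k m"
proof -
  have "{j. 1 \<le> j \<and> j \<le> Suc m} = insert (Suc m) {j. 1 \<le> j \<and> j \<le> m}" by auto
  then show ?thesis unfolding E_def setcompr_eq_image by auto
qed

lemma E_Suc_0: "E (Suc k) 0 = {int k + 1, - (int k + 1)} \<union> E k 0"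
  unfolding E_def by auto

text \<open>For \<open>k = 0\<close> the set is a dilated interval. This second description allows
  \<open>k \<ge> 1\<close> to be assumed for every affine image with more than one point.\<close>

lemma E_0_left: "E 0 m = (\<lambda>x. 2 * x) ` E m 0"
proof
  show "E 0 m \<subseteq> (\<lambda>x. 2 * x) ` E m 0"
    unfolding E_def by auto
  show "(\<lambda>x. 2 * x) ` E m 0 \<subseteq> E 0 m"
  proof clarify
    fix x assume "x \<in> E m 0"
    then have "\<bar>x\<bar> \<le> int m" using E_bounds by fastforce
    then consider "x = 0" | "x = int (nat x)" "1 \<le> nat x" "nat x \<le> m"
      | "x = - int (nat (- x))" "1 \<le> nat (- x)" "nat (- x) \<le> m"
      by linarith
    then show "2 * x \<in> E 0 m"
    proof cases
      case 2
      then have "2 * x = int 0 + 2 * int (nat x)" by simp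
      then show ?thesis unfolding E_def using 2 by blast
    next
      case 3
      then have "2 * x = - (int 0 + 2 * int (nat (- x)))" by simp
      then show ?thesis unfolding E_def using 3 by blast
    qed (simp add: zero_mem_E)
  qed
qed

text \<open>Together with \<open>E_Suc_right\<close> this shows that the same new point yields an
  \<open>F\<close> when added alone and an \<open>E\<close> when added with its mirror
  image.\<close>

lemma F_Suc_right: "F k (Suc m) = insert (int k + 2 * int m + 2) (E k m)"
proof -
  have "{j. 1 \<le> j \<and> j \<le> Suc m} = insert (Suc m) {j. 1 \<le> j \<and> j \<le> m}" by auto
  then show ?thesis
    using F_pos[of "Suc m" k] unfolding E_def setcompr_eq_image by auto
qed

lemma F_Suc_0: "F (Suc k) 0 = insert (int k + 1) (E k 0)"
  unfolding E_def F_def by auto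

text \<open>The translation \<open>b\<close> is a parameter because it is the centre of symmetry of
  the image, about which later reflections are taken.\<close>

definition E_image :: "int \<Rightarrow> int set \<Rightarrow> bool" where
  "E_image b A \<longleftrightarrow> (\<exists>a k m. a \<noteq> 0 \<and> A = (\<lambda>x. a * x + b) ` E k m)"

definition F_image :: "int \<Rightarrow> int set \<Rightarrow> bool" where
  "F_image b A \<longleftrightarrow> (\<exists>a k m. a \<noteq> 0 \<and> A = (\<lambda>x. a * x + b) ` F k m)"

lemma E_image_center: "E_image b A \<Longrightarrow> b \<in> A"
  unfolding E_image_def using zero_mem_E by (force simp: image_iff)

lemma E_image_symmetric: "\<lbrakk>E_image b A; x \<in> A\<rbrakk> \<Longrightarrow> 2 * b - x \<in> A"
  unfolding E_image_def by (auto simp: image_iff intro!: bexI[OF _ uminus_mem_E])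

lemma E_image_below_eq_above: "num_below A b = num_above A b" if "E_image b A"
proof -
  have "bij_betw (\<lambda>x. 2 * b - x) {x \<in> A. x < b} {x \<in> A. b < x}"
    using E_image_symmetric[OF that]
    by (intro bij_betw_byWitness[where f' = "\<lambda>x. 2 * b - x"]) auto
  then show ?thesis
    unfolding num_below_def num_above_def by (rule bij_betw_same_card)
qed

text \<open>The symmetry of \<open>E k m\<close> makes the sign of \<open>a\<close> irrelevant, and
  \<open>k = 0\<close> is absorbed by doubling \<open>a\<close>. With \<open>a > 0\<close> and
  \<open>k \<ge> 1\<close> the smallest element above \<open>b\<close> is \<open>a + b\<close>, the
  point needed for locating a new maximum.\<close>

lemma E_image_cases:
  assumes "E_image b A"
  obtains "A = {b}" | a k m where "a > 0" "k \<ge> 1" "A = (\<lambda>x. a * x + b) ` E k m"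
proof -
  obtain a k m where akm: "a \<noteq> 0" "A = (\<lambda>x. a * x + b) ` E k m"
    using assms by (auto simp: E_image_def)
  have pos: "A = (\<lambda>x. \<bar>a\<bar> * x + b) ` E k m"
  proof (cases "a > 0")
    case False
    have "(\<lambda>x. a * x + b) ` E k m = (\<lambda>x. a * x + b) ` uminus ` E k m"
    proof -
      have "uminus ` E k m = E k m"
        using uminus_mem_E by (auto simp: image_iff intro!: bexI[OF _ uminus_mem_E])
      then show ?thesis by simp
    qed
    then show ?thesis using False akm by (simp add: image_image)
  qed (use akm in simp)
  show ?thesis
  proof (cases "k \<ge> 1")
    case True
    then show ?thesis using that(2)[of "\<bar>a\<bar>"] akm(1) pos by simp
  next
    case False
    then have "k = 0" by simp
    then have A: "A = (\<lambda>x. 2 * \<bar>a\<bar> * x + b) ` E m 0"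
      using pos by (simp add: E_0_left image_image mult_ac)
    show ?thesis
    proof (cases "m \<ge> 1")
      case True
      then show ?thesis using that(2)[of "2 * \<bar>a\<bar>"] akm(1) A by simp
    next
      case False
      then have "m = 0" by simp
      then have "A = {b}" using A by (simp add: E_def)
      then show ?thesis by (rule that(1))
    qed
  qed
qed

text \<open>In coordinates where \<open>A\<close> is \<open>E k m\<close> with maximum
  \<open>?M\<close>, reflecting \<open>t\<close> in \<open>?M\<close> gives some \<open>x\<close> in
  the set, so \<open>t\<close> sits at \<open>2 * ?M - x\<close>. Reflecting \<open>t\<close> in 1
  must not fall below \<open>- ?M\<close>, which leaves only \<open>?M + 1\<close> and
  \<open>?M + 2\<close> for \<open>t\<close>. Both continue the family.\<close>

lemma E_image_extend:
  assumes img: "E_image b A" and t: "\<And>e. e \<in> A \<Longrightarrow> e < t"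
    and refl: "\<And>e. \<lbrakk>e \<in> A; b < e\<rbrakk> \<Longrightarrow> 2 * e - t \<in> A"
  shows "E_image b ({t, 2 * b - t} \<union> A) \<and> F_image b (insert t A)"
  using img
proof (cases rule: E_image_cases)
  case 1
  have E: "E 1 0 = {1, -1, 0}" using E_Suc_0[of 0] by (auto simp: E_def)
  have F: "F 1 0 = {1, 0}" using F_Suc_0[of 0] by (auto simp: E_def)
  \<comment> \<open>Around a single point any position of \<open>t\<close> is possible; its distance
    from \<open>b\<close> becomes the scaling factor.\<close>
  have "t - b \<noteq> 0" using t[of b] 1 by simp
  moreover have "{t, 2 * b - t} \<union> A = (\<lambda>x. (t - b) * x + b) ` E 1 0"
    unfolding E 1 by auto
  moreover have "insert t A = (\<lambda>x. (t - b) * x + b) ` F 1 0"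
    unfolding F 1 by auto
  ultimately show ?thesis unfolding E_image_def F_image_def by blast
next
  case (2 a k m)
  let ?M = "int k + 2 * int m"
  have "a * ?M + b \<in> A" using 2 max_mem_E by blast
  moreover have "b < a * ?M + b" using 2 by simp
  ultimately have "2 * (a * ?M + b) - t \<in> A" by (rule refl)
  then obtain x where x: "x \<in> E k m" and tx: "2 * (a * ?M + b) - t = a * x + b"
    using 2 by auto
  then have t_eq: "t = a * (2 * ?M - x) + b" by (simp add: algebra_simps)
  have "1 \<in> E k m" using 2 by (simp add: E_def)
  then have "a * 1 + b \<in> A" using 2 by blast
  then have "2 * (a * 1 + b) - t \<in> A" by (rule refl) (use 2 in simp)
  then obtain y where y: "y \<in> E k m" "2 * (a * 1 + b) - t = a * y + b"
    using 2 by auto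
  then have "a * y = a * (2 - 2 * ?M + x)" using t_eq by (simp add: algebra_simps)
  then have "y = 2 - 2 * ?M + x" using 2 by simp
  \<comment> \<open>This is \<open>y \<ge> - ?M\<close> rewritten through the preceding
    equation.\<close>
  then have "x \<ge> ?M - 2" using E_bounds[OF y(1)] by (simp add: abs_le_iff)
  moreover have "x < ?M"
  proof -
    have "a * ?M + b < a * (2 * ?M - x) + b" using t[OF \<open>a * ?M + b \<in> A\<close>] t_eq by simp
    then have "a * ?M < a * (2 * ?M - x)" by simp
    then show ?thesis using 2 by simp
  qed
  ultimately consider "x = ?M - 2" | "x = ?M - 1" by linarith
  then obtain k' m' s where s: "t = a * s + b"
    and E: "E k' m' = {s, - s} \<union> E k m" and F: "F k' m' = insert s (E k m)"
  proof cases
    case 1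
    with that[of "?M + 2" k "Suc m"] show ?thesis
      using t_eq E_Suc_right F_Suc_right by simp
  next
    case 2
    \<comment> \<open>For positive \<open>m\<close> the elements beyond \<open>k\<close> have the
      parity of \<open>k\<close>, so \<open>?M - 1\<close> is a gap of \<open>E k m\<close> and
      cannot be \<open>x\<close>.\<close>
    have "m = 0"
    proof (rule ccontr)
      assume "m \<noteq> 0"
      then show False using x 2 by (auto simp: E_def) presburger
    qed
    with 2 that[of "?M + 1" "Suc k" 0] show ?thesis
      using t_eq E_Suc_0 F_Suc_0 by simp
  qed
  have "{t, 2 * b - t} \<union> A = (\<lambda>x. a * x + b) ` E k' m'"
    unfolding E 2(3) s by auto
  moreover have "insert t A = (\<lambda>x. a * x + b) ` F k' m'"
    unfolding F 2(3) s by auto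
  moreover have "a \<noteq> 0" using 2 by simp
  ultimately show ?thesis unfolding E_image_def F_image_def by blast
qed

section \<open>Classification of the extremal sets\<close>

lemma extremal_odd:
  assumes "extremal A" "card A = 2 * p + 1"
  shows "\<exists>b. E_image b A"
  using assms
proof (induction p arbitrary: A)
  case 0
  then obtain b where "A = {b}" by (auto simp: card_1_singleton_iff)
  then have "E_image b A"
    unfolding E_image_def by (intro exI[of _ 1] exI[of _ 0]) (simp add: E_def)
  then show ?case ..
next
  case (Suc p)
  let ?s = "Min A" and ?t = "Max A"
  let ?B = "A - {?s, ?t}"
  have fin: "finite A" using Suc.prems by (simp add: extremal_def)
  have ne: "A \<noteq> {}" using Suc.prems by auto
  have mem: "?s \<in> A" "?t \<in> A" using fin ne by auto
  have "?s \<noteq> ?t"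
  proof
    assume "?s = ?t"
    then have "A \<subseteq> {?t}" using fin by (metis Max_ge Min_le antisym singletonI subsetI)
    then have "card A \<le> 1" using card_mono[of "{?t}" A] by simp
    then show False using Suc.prems by simp
  qed
  then have "card ?B = 2 * p + 1" using Suc.prems fin mem by (simp add: card_Diff_subset)
  moreover have "extremal ?B" using extremal_remove_ends Suc.prems by simp
  ultimately obtain b where img: "E_image b ?B" using Suc.IH by blast
  have b: "b \<in> ?B" by (rule E_image_center[OF img])
  have bd: "?s < e" "e < ?t" if "e \<in> ?B" for e
    using that fin by (auto simp: less_le)
  have "{x \<in> A. x < b} = insert ?s {x \<in> ?B. x < b}" "{x \<in> A. b < x} = insert ?t {x \<in> ?B. b < x}"
    using bd[OF b] mem by auto
  \<comment> \<open>The centre of the inner set is also the median of \<open>A\<close>. Hence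
    \<open>Max A\<close> may be reflected in every inner point from \<open>b\<close>
    upwards.\<close>
  then have eq: "num_below A b = num_above A b"
    using E_image_below_eq_above[OF img] fin by (simp add: num_below_def num_above_def)
  have up: "2 * e - ?t \<in> A" if "e \<in> ?B" "b \<le> e" for e
  proof -
    have "num_above A e \<le> num_below A e"
      using above_antimono[OF fin that(2)] below_mono[OF fin that(2)] eq by linarith
    then show ?thesis using extremal_above[OF Suc.prems(1)] that bd mem by auto
  qed
  have "2 * b - ?s \<in> A"
    using extremal_below[OF Suc.prems(1)] b bd mem eq by auto
  \<comment> \<open>Both end points reflect in \<open>b\<close> into \<open>A\<close>; neither can
    then be farther from \<open>b\<close> than the other.\<close>
  then have "2 * b - ?s \<le> ?t" using fin by simp
  moreover have "?s \<le> 2 * b - ?t" using up[OF b] fin by simp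
  ultimately have s: "?s = 2 * b - ?t" by simp
  \<comment> \<open>The reflected point avoids \<open>?s\<close>: from \<open>b < e\<close> it
    exceeds \<open>2 * b - ?t = ?s\<close>.\<close>
  have "2 * e - ?t \<in> ?B" if "e \<in> ?B" "b < e" for e
    using up[of e] bd[OF that(1)] that s by auto
  then have "E_image b ({?t, 2 * b - ?t} \<union> ?B)"
    using E_image_extend[OF img, of ?t] bd by blast
  also have "{?t, 2 * b - ?t} \<union> ?B = A" using mem s by auto
  finally show ?case ..
qed

text \<open>The remaining set has odd size and so is an image of some \<open>E k m\<close>, balanced
  about its centre \<open>b\<close>. Beyond \<open>b\<close> the left side is larger by enough to
  absorb the extra point \<open>Max A\<close> on the right, so \<open>Max A\<close> reflects in all
  those elements and \<open>E_image_extend\<close> locates it.\<close>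

lemma extremal_even_remove_Max:
  assumes ext: "extremal A" and ext': "extremal (A - {Max A})"
    and card: "card A = 2 * p" and "p \<ge> 1"
  shows "\<exists>b. F_image b A"
proof -
  let ?t = "Max A"
  let ?B = "A - {?t}"
  have fin: "finite A" using ext by (simp add: extremal_def)
  have t: "?t \<in> A" using fin card \<open>p \<ge> 1\<close> by (intro Max_in) auto
  have "card ?B = 2 * (p - 1) + 1" using card \<open>p \<ge> 1\<close> t by simp
  then obtain b where img: "E_image b ?B" using extremal_odd[OF ext'] by blast
  have bd: "e < ?t" if "e \<in> ?B" for e using that fin by (auto simp: less_le)
  have b: "b \<in> ?B" by (rule E_image_center[OF img])
  have above: "num_above A e = num_above ?B e + 1" and below: "num_below A e = num_below ?B e" if "e \<in> ?B" for e
  proof -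
    have "{x \<in> A. e < x} = insert ?t {x \<in> ?B. e < x}" using bd[OF that] t by auto
    then show "num_above A e = num_above ?B e + 1" using fin by (simp add: num_above_def)
    show "num_below A e = num_below ?B e"
      unfolding num_below_def using bd[OF that] by (intro arg_cong[where f = card]) auto
  qed
  have "2 * e - ?t \<in> ?B" if e: "e \<in> ?B" "b < e" for e
  proof -
    \<comment> \<open>Strictness, from counting \<open>b\<close> itself, compensates for the one
      element more that \<open>num_above A e\<close> has over \<open>num_above ?B e\<close>.\<close>
    have "num_below ?B b < num_below ?B e" using below_less[of ?B] fin b e by simp
    moreover have "num_above ?B e \<le> num_above ?B b" using above_antimono[of ?B] fin e by simp
    ultimately have "num_above A e \<le> num_below A e"
      using above below e E_image_below_eq_above[OF img] by simp
    then have "2 * e - ?t \<in> A" using extremal_above[OF ext] e bd t by auto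
    then show ?thesis using bd[OF e(1)] by auto
  qed
  then have "F_image b (insert ?t ?B)"
    using E_image_extend[OF img, of ?t] bd by blast
  also have "insert ?t ?B = A" using t by auto
  finally show ?thesis ..
qed

lemma F_image_uminus: "F_image b (uminus ` A) \<Longrightarrow> F_image (- b) A"
proof -
  assume "F_image b (uminus ` A)"
  then obtain a k m where a: "a \<noteq> 0" and A: "uminus ` A = (\<lambda>x. a * x + b) ` F k m"
    by (auto simp: F_image_def)
  have "A = uminus ` uminus ` A" by (simp add: image_image)
  also have "\<dots> = (\<lambda>x. - a * x + - b) ` F k m"
    unfolding A by (simp add: image_image)
  finally show ?thesis
    unfolding F_image_def using a by (metis neg_equal_0_iff_equal)
qed

lemma extremal_even:
  assumes ext: "extremal A" and card: "card A = 2 * p" and "p \<ge> 1"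
  shows "\<exists>b. F_image b A"
proof -
  have fin: "finite A" using ext by (simp add: extremal_def)
  consider "extremal (A - {Max A})" | "extremal (A - {Min A})"
    using extremal_remove_Min_or_Max[OF assms] by blast
  then show ?thesis
  proof cases
    case 1
    then show ?thesis using extremal_even_remove_Max assms by blast
  next
    case 2
    have "A \<noteq> {}" using card \<open>p \<ge> 1\<close> by auto
    then have Max: "Max (uminus ` A) = - Min A"
      using fin by (intro Max_eqI) auto
    have "uminus ` (A - {Min A}) = uminus ` A - {Max (uminus ` A)}"
      unfolding Max by auto
    then have "extremal (uminus ` A - {Max (uminus ` A)})"
      using extremal_uminus[OF 2] by simp
    moreover have "card (uminus ` A) = 2 * p" using card by (simp add: card_image)
    ultimately obtain b where "F_image b (uminus ` A)"
      using extremal_even_remove_Max[OF extremal_uminus[OF ext]] \<open>p \<ge> 1\<close> by blast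
    then show ?thesis using F_image_uminus by blast
  qed
qed

lemma ceiling_half: "\<lceil>real m / 2\<rceil> = int ((m + 1) div 2)"
  by (rule ceiling_unique) linarith+

theorem theorem1p2:
  fixes n :: nat
  assumes "n \<ge> 1"
  shows "int (M3 n) = \<lceil>(real n)\<^sup>2 / 2\<rceil> \<and>
    (\<forall>A :: int set. card A = n \<and> T3 A = M3 n \<longrightarrow>
      (\<exists>a b :: int. \<exists>k m :: nat. a \<noteq> 0 \<and>
        (A = (\<lambda>x. a * x + b) ` E k m \<or> A = (\<lambda>x. a * x + b) ` F k m)))"
proof (intro conjI allI impI)
  show "int (M3 n) = \<lceil>(real n)\<^sup>2 / 2\<rceil>"
    using ceiling_half[of "n\<^sup>2"] M3_eq[OF assms] by simp
next
  fix A :: "int set" assume A: "card A = n \<and> T3 A = M3 n"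
  \<comment> \<open>A set of positive \<open>card\<close> is finite, because \<open>card\<close> is
    0 on infinite sets.\<close>
  then have "finite A" using assms by (intro card_ge_0_finite) simp
  then have ext: "extremal A"
    using A T3_eq_iff_extremal[OF \<open>finite A\<close>] M3_eq[OF assms] by simp
  have "\<exists>b. E_image b A \<or> F_image b A"
  proof (cases "even n")
    case True
    then obtain p where "n = 2 * p" by blast
    then show ?thesis using extremal_even[OF ext, of p] A assms by auto
  next
    case False
    then obtain p where "n = 2 * p + 1" by (rule oddE)
    then show ?thesis using extremal_odd[OF ext, of p] A by auto
  qed
  then show "\<exists>a b :: int. \<exists>k m :: nat. a \<noteq> 0 \<and>
      (A = (\<lambda>x. a * x + b) ` E k m \<or> A = (\<lambda>x. a * x + b) ` F k m)"
    unfolding E_image_def F_image_def by blast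
qed

end
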